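(* Let $T>1$ be a real number and let $m\geq 1$ be an integer. Let $f_1,\dots,f_{2m}:[1,T]\times\mathbb{R}\to\mathbb{R}$, $p:[1,T]\to\mathbb{R}$ and $\mathcal{G}:[1,T]\times[1,T]\to[0,\infty)$ be functions satisfying the following assumptions. (a) $f_i$ is continuous for every $1\leq i\leq 2m$. (b) $p$ is continuous. (c) $\mathcal{G}$ is continuous (and takes values in $[0,\infty)$). (d) There exist positive constants $\eta_1,\dots,\eta_{2m}$ such that $$\max_{1\leq i\leq 2m}\eta_i\leq\Big(2m\max_{1\leq t\leq T}\int_1^T\mathcal{G}(t,s)\,ds\Big)^{-1}$$ (where the quantity being inverted is assumed to be nonzero), and for all $s\in[1,T]$, all $x,y\in\mathbb{R}$ with $y\geq x$, and all $1\leq i\leq m$, $$0\leq f_{2i-1}(s,y)-f_{2i-1}(s,x)\leq\eta_{2i-1}\log(1+y-x),$$ $$-\eta_{2i}\log(1+y-x)\leq f_{2i}(s,y)-f_{2i}(s,x)\leq 0.$$ (e) There exist continuous functions $y^0_1,\dots,y^0_{2m}:[1,T]\to\mathbb{R}$ such that for all $1\leq r\leq m$ and all $t\in[1,T]$, $$y^0_{2r-1}(t)\leq H_{2r-1}(t)\quad\text{and}\quad y^0_{2r}(t)\geq H_{2r}(t),$$ where $$H_1(t)=\int_1^T\mathcal{G}(t,s)\Big[\sum_{i=1}^{2m}f_i(s,y^0_i(s))\Big]ds+p(t)$$ and, for $2\leq r\leq 2m$, $$H_r(t)=\int_1^T\mathcal{G}(t,s)\Big[\sum_{i=1}^{2m-r+1}f_i(s,y^0_{i+r-1}(s))+\sum_{\ell=0}^{r-2}f_{2m-\ell}(s,y^0_{r-1-\ell}(s))\Big]ds+p(t).$$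 Then the nonlinear Hammerstein integral equation $$x(t)=\int_1^T\mathcal{G}(t,s)\Big[\sum_{i=1}^{2m}f_i(s,x(s))\Big]ds+p(t),\qquad t\in[1,T],$$ has a unique solution $x\in C([1,T])$.
   Context: $C([1,T])$ denotes the space of continuous real-valued functions on $[1,T]$. A solution is a function $x\in C([1,T])$ for which the equation holds for every $t\in[1,T]$. $\log$ is the natural logarithm. *)

theory Defs
  imports "HOL-Analysis.Analysis"
begin

text \<open>Functions with domain \<open>[1,T]\<close> are total functions on the reals of which only the values on
  \<open>{1..T}\<close> matter. For uniqueness of solutions, elements of \<open>C([1,T])\<close> are made
  canonical by requiring the value \<open>undefined\<close> outside \<open>[1,T]\<close>.\<close>

definition C_space :: "real \<Rightarrow> (real \<Rightarrow> real) set" where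
  "C_space T = {x \<in> extensional {1..T}. continuous_on {1..T} x}"

text \<open>For continuous \<open>G\<close> the inner integral is continuous in \<open>t\<close>, so this supremum over the
  compact interval is attained, i.e. it is the maximum.\<close>

definition max_kernel_integral :: "real \<Rightarrow> (real \<Rightarrow> real \<Rightarrow> real) \<Rightarrow> real" where
  "max_kernel_integral T G = (SUP t\<in>{1..T}. integral {1..T} (\<lambda>s. G t s))"

text \<open>Indices are 1-based throughout: \<open>f i\<close> and \<open>y i\<close> are used for \<open>1 \<le> i \<le> 2 m\<close>, and \<open>H\<close> for
  \<open>1 \<le> r \<le> 2 m\<close>. The case \<open>r = 1\<close> must be separate, since \<open>{0..r - 2}\<close> with truncated
  subtraction would not be empty there.\<close>

definition H ::
  "real \<Rightarrow> nat \<Rightarrow> (real \<Rightarrow> real \<Rightarrow> real) \<Rightarrow> (nat \<Rightarrow> real \<Rightarrow> real \<Rightarrow> real) \<Rightarrow> (real \<Rightarrow> real)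
    \<Rightarrow> (nat \<Rightarrow> real \<Rightarrow> real) \<Rightarrow> nat \<Rightarrow> real \<Rightarrow> real" where
  "H T m G f p y r t =
    (if r = 1 then
       integral {1..T} (\<lambda>s. G t s * (\<Sum>i=1..2*m. f i s (y i s))) + p t
     else
       integral {1..T} (\<lambda>s. G t s *
         ((\<Sum>i=1..2*m-r+1. f i s (y (i+r-1) s)) +
          (\<Sum>l=0..r-2. f (2*m-l) s (y (r-1-l) s)))) + p t)"

definition hammerstein_solution ::
  "real \<Rightarrow> nat \<Rightarrow> (real \<Rightarrow> real \<Rightarrow> real) \<Rightarrow> (nat \<Rightarrow> real \<Rightarrow> real \<Rightarrow> real) \<Rightarrow> (real \<Rightarrow> real)
    \<Rightarrow> (real \<Rightarrow> real) \<Rightarrow> bool" where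
  "hammerstein_solution T m G f p x \<longleftrightarrow>
    x \<in> C_space T \<and>
    (\<forall>t\<in>{1..T}. x t = integral {1..T} (\<lambda>s. G t s * (\<Sum>i=1..2*m. f i s (x s))) + p t)"

end

theory Submission
  imports Defs
begin

text \<open>Each \<open>f i\<close> is monotone in its second argument, so hypothesis (d) gives
  \<open>\<bar>f i s y - f i s x\<bar> \<le> \<eta> i * ln (1 + \<bar>y - x\<bar>)\<close> irrespective of the parity of \<open>i\<close>. With the bound on
  the \<open>\<eta> i\<close>, the Hammerstein operator \<open>A\<close> on \<open>C([1,T])\<close> satisfies
  \<open>dist (A u) (A v) \<le> ln (1 + dist u v)\<close>. Since \<open>ln (1 + d) < d\<close> for \<open>d > 0\<close>, it is a Meir--Keeler
  contraction, which has exactly one fixed point.\<close>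

section \<open>Fixed points of Meir--Keeler contractions\<close>

text \<open>Taking \<epsilon> as the distance of two distinct points shows that \<open>A\<close>
  strictly shortens distances, whence uniqueness. For existence, the step lengths of an orbit tend
  to 0, the condition then confines its tail, and the limit is fixed because \<open>A\<close> is
  nonexpansive.\<close>

lemma Meir_Keeler_fixed_point:
  fixes A :: "'a::complete_space \<Rightarrow> 'a"
  assumes MK: "\<And>\<epsilon>. \<epsilon> > 0 \<Longrightarrow> \<exists>\<delta>>0. \<forall>x y. dist x y < \<epsilon> + \<delta> \<longrightarrow> dist (A x) (A y) < \<epsilon>"
  shows "\<exists>!x. A x = x"
proof -
  have contractive: "dist (A x) (A y) < dist x y" if "x \<noteq> y" for x y
  proof -
    obtain \<delta> where "\<delta> > 0"
      "\<forall>u v. dist u v < dist x y + \<delta> \<longrightarrow> dist (A u) (A v) < dist x y"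
      using MK[of "dist x y"] \<open>x \<noteq> y\<close> by auto
    then show ?thesis by (simp add: \<open>\<delta> > 0\<close>)
  qed
  have nonexpansive: "dist (A x) (A y) \<le> dist x y" for x y
    using contractive[of x y] by (cases "x = y") auto
  \<comment> \<open>\<open>undefined\<close> is merely some starting point; any would do.\<close>
  define X where "X n = (A ^^ n) undefined" for n
  have X_Suc: "X (Suc n) = A (X n)" for n
    by (simp add: X_def)
  define d where "d n = dist (X n) (X (Suc n))" for n
  have d_nonneg: "d n \<ge> 0" for n
    by (simp add: d_def)
  have d_dec: "decseq d"
    by (rule decseq_SucI) (auto simp: d_def X_Suc intro: nonexpansive)
  then obtain l where d_lim: "d \<longlonglongrightarrow> l" and d_ge: "\<forall>n. l \<le> d n"
    using decseq_convergent[of d 0] d_nonneg by blast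
  \<comment> \<open>If \<open>l > 0\<close>, a step shorter than \<open>l + \<delta>\<close> is
    followed by one shorter than \<open>l\<close>, although \<open>l\<close> is a lower bound of all
    steps.\<close>
  have "l = 0"
  proof (rule ccontr)
    assume "l \<noteq> 0"
    moreover have "l \<ge> 0"
      using LIMSEQ_le_const[OF d_lim, of 0] d_nonneg by auto
    ultimately have "l > 0" by simp
    then obtain \<delta> where "\<delta> > 0" and
      \<delta>: "\<And>x y. dist x y < l + \<delta> \<Longrightarrow> dist (A x) (A y) < l"
      using MK[of l] by blast
    have "\<forall>\<^sub>F n in sequentially. d n < l + \<delta>"
      by (rule order_tendstoD[OF d_lim]) (simp add: \<open>\<delta> > 0\<close>)
    then obtain n where "d n < l + \<delta>"
      using eventually_happens by force
    then have "d (Suc n) < l"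
      using \<delta> by (simp add: d_def X_Suc)
    with d_ge show False by (meson not_less)
  qed
  have "Cauchy X"
    unfolding Cauchy_altdef
  proof (intro allI impI)
    fix e :: real assume "e > 0"
    define \<epsilon> where "\<epsilon> = e / 2"
    have "\<epsilon> > 0" using \<open>e > 0\<close> by (simp add: \<epsilon>_def)
    then obtain \<delta>' where "\<delta>' > 0" and
      \<delta>': "\<And>x y. dist x y < \<epsilon> + \<delta>' \<Longrightarrow> dist (A x) (A y) < \<epsilon>"
      using MK[of \<epsilon>] by blast
    \<comment> \<open>\<open>\<delta> < \<delta>'\<close> keeps the trapped distances within reach
      of the condition at \<epsilon>; \<open>2 * \<delta> \<le> \<epsilon>\<close> gives
      \<open>\<epsilon> + \<delta> < 2 * \<epsilon> = e\<close>.\<close>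
    define \<delta> where "\<delta> = min \<delta>' \<epsilon> / 2"
    have \<delta>: "\<delta> > 0" "\<delta> < \<delta>'" "2 * \<delta> \<le> \<epsilon>"
      using \<open>\<delta>' > 0\<close> \<open>\<epsilon> > 0\<close> by (auto simp: \<delta>_def)
    have "\<forall>\<^sub>F n in sequentially. d n < \<delta>"
      using order_tendstoD(2)[OF d_lim] \<open>l = 0\<close> \<delta> by simp
    then obtain N where N: "\<And>n. n \<ge> N \<Longrightarrow> d n < \<delta>"
      by (auto simp: eventually_sequentially)
    \<comment> \<open>The ball of radius \<open>\<epsilon> + \<delta>\<close> around \<open>X k\<close> traps all later iterates.\<close>
    have "dist (X k) (X (k + j)) < \<epsilon> + \<delta>" if "k \<ge> N" for k j
    proof (induction j)
      case 0
      show ?case using \<open>\<epsilon> > 0\<close> \<delta> by simp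
    next
      case (Suc j)
      \<comment> \<open>Detour through \<open>X (Suc k)\<close>: one step costs less than \<delta>,
        and the rest is the image under \<open>A\<close> of a pair covered by the induction
        hypothesis, hence below \<epsilon>.\<close>
      have "dist (X k) (X (k + Suc j)) \<le> d k + dist (A (X k)) (A (X (k + j)))"
        unfolding d_def by (metis X_Suc add_Suc_right dist_triangle)
      also have "\<dots> < \<delta> + \<epsilon>"
        using N[OF that] \<delta>'[of "X k" "X (k + j)"] Suc \<delta> by force
      finally show ?case by simp
    qed
    moreover have "\<epsilon> + \<delta> < e"
      using \<delta> \<open>\<epsilon> > 0\<close> by (simp add: \<epsilon>_def)
    ultimately have "dist (X k) (X n) < e" if "k \<ge> N" "n > k" for k n
      using that by (metis less_imp_add_positive order.strict_trans)
    then show "\<exists>M. \<forall>k\<ge>M. \<forall>n>k. dist (X k) (X n) < e"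
      by blast
  qed
  then obtain x where x: "X \<longlonglongrightarrow> x"
    using Cauchy_convergent_iff convergent_def by blast
  have "(\<lambda>n. dist (X n) x) \<longlonglongrightarrow> 0"
    using x tendsto_dist_iff by blast
  then have "(\<lambda>n. dist (X (Suc n)) (A x)) \<longlonglongrightarrow> 0"
    by (rule Lim_null_comparison[rotated]) (auto simp: X_Suc nonexpansive)
  then have "(\<lambda>n. X (Suc n)) \<longlonglongrightarrow> A x"
    using tendsto_dist_iff by blast
  then have "A x = x"
    using x LIMSEQ_Suc LIMSEQ_unique by blast
  moreover have "y = x" if "A y = y" for y
    using contractive[of y x] that \<open>A x = x\<close> by auto
  ultimately show ?thesis by blast
qed

lemma ln_contraction_fixed_point:
  fixes A :: "'a::complete_space \<Rightarrow> 'a"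
  assumes "\<And>x y. dist (A x) (A y) \<le> ln (1 + dist x y)"
  shows "\<exists>!x. A x = x"
proof (rule Meir_Keeler_fixed_point)
  fix \<epsilon> :: real assume "\<epsilon> > 0"
  show "\<exists>\<delta>>0. \<forall>x y. dist x y < \<epsilon> + \<delta> \<longrightarrow> dist (A x) (A y) < \<epsilon>"
  \<comment> \<open>The witness makes \<open>\<epsilon> + \<delta>\<close> equal to
    \<open>exp \<epsilon> - 1\<close>, the distance at which \<open>ln (1 + d)\<close> reaches
    \<epsilon>. Its positivity is \<open>ln (1 + \<epsilon>) < \<epsilon>\<close>,
    exponentiated.\<close>
  proof (intro exI[of _ "exp \<epsilon> - 1 - \<epsilon>"] conjI allI impI)
    show "exp \<epsilon> - 1 - \<epsilon> > 0"
      using exp_minus_ge[of "- \<epsilon>"] exp_gt_one[of "\<epsilon>"] \<open>\<epsilon> > 0\<close> ln_add_one_self_less_self[of \<epsilon>]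
      by (smt (verit) exp_less_mono exp_ln)
    fix x y :: 'a assume "dist x y < \<epsilon> + (exp \<epsilon> - 1 - \<epsilon>)"
    then have "1 + dist x y < exp \<epsilon>" by simp
    then have "ln (1 + dist x y) < \<epsilon>"
      by (smt (verit) ln_exp ln_less_cancel_iff zero_le_dist)
    with assms[of x y] show "dist (A x) (A y) < \<epsilon>" by simp
  qed
qed

section \<open>Continuity of kernel integrals\<close>

lemma kernel_product_continuous:
  fixes G F :: "real \<Rightarrow> real \<Rightarrow> real"
  assumes G: "continuous_on ({a..b} \<times> {a..b}) (\<lambda>(t, s). G t s)"
    and F: "continuous_on ({a..b} \<times> UNIV) (\<lambda>(s, x). F s x)"
    and x: "continuous_on {a..b} x"
  shows "continuous_on ({a..b} \<times> {a..b}) (\<lambda>(t, s). G t s * F s (x s))"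
proof -
  have "continuous_on ({a..b} \<times> {a..b}) (\<lambda>z. x (snd z))"
    by (rule continuous_on_compose2[OF x]) (auto intro: continuous_intros)
  then have "continuous_on ({a..b} \<times> {a..b}) (\<lambda>z. (snd z, x (snd z)))"
    by (intro continuous_intros)
  then have "continuous_on ({a..b} \<times> {a..b}) (\<lambda>z. F (snd z) (x (snd z)))"
    using continuous_on_compose2[OF F, of _ "\<lambda>z. (snd z, x (snd z))"] by force
  then show ?thesis
    using continuous_on_mult[OF G] by (simp add: case_prod_unfold)
qed

lemma continuous_on_section:
  fixes g :: "real \<Rightarrow> real \<Rightarrow> real"
  assumes "continuous_on ({a..b} \<times> {a..b}) (\<lambda>(t, s). g t s)" "t \<in> {a..b}"
  shows "continuous_on {a..b} (g t)"
  using continuous_on_compose2[OF assms(1), of "{a..b}" "\<lambda>s. (t, s)"] assms(2)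
  by (force intro: continuous_intros)

lemma continuous_on_param_integral:
  fixes g :: "real \<Rightarrow> real \<Rightarrow> real"
  assumes "continuous_on ({a..b} \<times> {a..b}) (\<lambda>(t, s). g t s)"
  shows "continuous_on {a..b} (\<lambda>t. integral {a..b} (g t))"
  using integral_continuous_on_param[of "{a..b}" a b g] assms by simp

section \<open>The Hammerstein operator with a single nonlinearity\<close>

text \<open>The logarithm is increasing, so the integrands differ by at most
  \<open>G t s * (L * ln (1 + D))\<close>. Integrating the kernel contributes at most
  \<open>K\<close>, and \<open>K * L \<le> 1\<close> absorbs both constants.\<close>

lemma Hammerstein_operator_bound:
  fixes a b K L :: real and G F :: "real \<Rightarrow> real \<Rightarrow> real"
  assumes F: "continuous_on ({a..b} \<times> UNIV) (\<lambda>(s, x). F s x)"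
    and G: "continuous_on ({a..b} \<times> {a..b}) (\<lambda>(t, s). G t s)"
    and G_nonneg: "\<And>t s. t \<in> {a..b} \<Longrightarrow> s \<in> {a..b} \<Longrightarrow> 0 \<le> G t s"
    and G_int: "\<And>t. t \<in> {a..b} \<Longrightarrow> integral {a..b} (G t) \<le> K"
    and F_ln: "\<And>s x y. s \<in> {a..b} \<Longrightarrow> \<bar>F s x - F s y\<bar> \<le> L * ln (1 + \<bar>x - y\<bar>)"
    and "L \<ge> 0" "K * L \<le> 1"
    and u: "continuous_on {a..b} u" and v: "continuous_on {a..b} v"
    and uv: "\<And>s. s \<in> {a..b} \<Longrightarrow> \<bar>u s - v s\<bar> \<le> D" and "D \<ge> 0"
    and t: "t \<in> {a..b}"
  shows "\<bar>integral {a..b} (\<lambda>s. G t s * F s (u s)) - integral {a..b} (\<lambda>s. G t s * F s (v s))\<bar>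
    \<le> ln (1 + D)"
proof -
  have iu: "(\<lambda>s. G t s * F s (u s)) integrable_on {a..b}"
    and iv: "(\<lambda>s. G t s * F s (v s)) integrable_on {a..b}"
    and iG: "G t integrable_on {a..b}"
    using continuous_on_section[OF kernel_product_continuous[OF G F u] t]
      continuous_on_section[OF kernel_product_continuous[OF G F v] t]
      continuous_on_section[OF G t]
    by (auto intro: integrable_continuous_interval)
  have "\<bar>integral {a..b} (\<lambda>s. G t s * F s (u s)) - integral {a..b} (\<lambda>s. G t s * F s (v s))\<bar>
      = norm (integral {a..b} (\<lambda>s. G t s * F s (u s) - G t s * F s (v s)))"
    using integral_diff[OF iu iv] by simp
  also have "\<dots> \<le> integral {a..b} (\<lambda>s. G t s * (L * ln (1 + D)))"
  proof (rule integral_norm_bound_integral)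
    show "(\<lambda>s. G t s * F s (u s) - G t s * F s (v s)) integrable_on {a..b}"
      using iu iv by (rule integrable_diff)
    show "(\<lambda>s. G t s * (L * ln (1 + D))) integrable_on {a..b}"
      using iG by (rule integrable_on_mult_left)
    fix s assume s: "s \<in> {a..b}"
    have "\<bar>F s (u s) - F s (v s)\<bar> \<le> L * ln (1 + \<bar>u s - v s\<bar>)"
      by (rule F_ln[OF s])
    also have "\<dots> \<le> L * ln (1 + D)"
      using uv[OF s] \<open>L \<ge> 0\<close> by (intro mult_left_mono) auto
    finally have "G t s * \<bar>F s (u s) - F s (v s)\<bar> \<le> G t s * (L * ln (1 + D))"
      by (rule mult_left_mono) (rule G_nonneg[OF t s])
    then show "norm (G t s * F s (u s) - G t s * F s (v s)) \<le> G t s * (L * ln (1 + D))"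
      using G_nonneg[OF t s] by (simp add: abs_mult flip: right_diff_distrib)
  qed
  also have "\<dots> = integral {a..b} (G t) * (L * ln (1 + D))"
    by simp
  also have "\<dots> \<le> K * (L * ln (1 + D))"
    using G_int[OF t] \<open>L \<ge> 0\<close> \<open>D \<ge> 0\<close> by (intro mult_right_mono) auto
  also have "\<dots> \<le> ln (1 + D)"
    using mult_right_mono[OF \<open>K * L \<le> 1\<close>, of "ln (1 + D)"] \<open>D \<ge> 0\<close> by (simp add: mult.assoc)
  finally show ?thesis .
qed

text \<open>The fixed point theorem speaks of a complete metric type, whereas solutions form a set
  of functions. The operator is therefore moved to the bounded continuous functions on the line with
  the sup metric, and its fixed point is restricted back to the interval.\<close>

lemma Hammerstein_unique_solution:
  fixes a b K L :: real and G F :: "real \<Rightarrow> real \<Rightarrow> real"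
  assumes "a \<le> b"
    and F: "continuous_on ({a..b} \<times> UNIV) (\<lambda>(s, x). F s x)"
    and p: "continuous_on {a..b} p"
    and G: "continuous_on ({a..b} \<times> {a..b}) (\<lambda>(t, s). G t s)"
    and G_nonneg: "\<And>t s. t \<in> {a..b} \<Longrightarrow> s \<in> {a..b} \<Longrightarrow> 0 \<le> G t s"
    and G_int: "\<And>t. t \<in> {a..b} \<Longrightarrow> integral {a..b} (G t) \<le> K"
    and F_ln: "\<And>s x y. s \<in> {a..b} \<Longrightarrow> \<bar>F s x - F s y\<bar> \<le> L * ln (1 + \<bar>x - y\<bar>)"
    and L: "L \<ge> 0" "K * L \<le> 1"
  shows "\<exists>!x. x \<in> extensional {a..b} \<and> continuous_on {a..b} x \<and>
    (\<forall>t\<in>{a..b}. x t = integral {a..b} (\<lambda>s. G t s * F s (x s)) + p t)"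
proof -
  define \<Phi> where "\<Phi> x t = integral {a..b} (\<lambda>s. G t s * F s (x s)) + p t" for x t
  have \<Phi>_cont: "continuous_on {a..b} (\<Phi> x)" if "continuous_on {a..b} x" for x
    unfolding \<Phi>_def
    by (intro continuous_on_add continuous_on_param_integral kernel_product_continuous G F p that)
  \<comment> \<open>The integral sees only values on the interval, so passing between a function,
    its extension and its restriction leaves \<open>\<Phi>\<close> unchanged.\<close>
  have \<Phi>_cong: "\<Phi> x t = \<Phi> y t" if "\<And>s. s \<in> {a..b} \<Longrightarrow> x s = y s" for x y t
    unfolding \<Phi>_def using that by (auto intro!: integral_cong)
  \<comment> \<open>\<open>C([a,b])\<close> is embedded into the bounded continuous functions on the line by constant
    extension beyond the end points.\<close>
  define E where "E x = Bcontfun (\<lambda>t. x (clamp a b t))" for x :: "real \<Rightarrow> real"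
  have E: "apply_bcontfun (E x) t = x (clamp a b t)" if "continuous_on {a..b} x" for x t
  proof -
    have "continuous_on UNIV (\<lambda>t. x (clamp a b t))"
      using that by (intro clamp_continuous_on) (simp add: box_real)
    moreover have "bounded (range (\<lambda>t. x (clamp a b t)))"
      using that by (intro clamp_bounded compact_imp_bounded compact_continuous_image) auto
    ultimately have "(\<lambda>t. x (clamp a b t)) \<in> bcontfun"
      by (simp add: bcontfun_def)
    then show ?thesis
      by (simp add: E_def Bcontfun_inverse)
  qed
  have clamp_in: "clamp a b t \<in> {a..b}" for t
    using clamp_in_interval[of a b t] \<open>a \<le> b\<close> by simp
  have clamp_id: "clamp a b t = t" if "t \<in> {a..b}" for t
    using clamp_cancel_cbox[of t a b] that by simp
  \<comment> \<open>\<open>A\<close> reads only the values of \<open>u\<close> on the interval and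
    returns a function constant beyond the end points, so a fixed point has this shape
    automatically.\<close>
  define A where "A u = E (\<Phi> (apply_bcontfun u))" for u
  have A: "apply_bcontfun (A u) t = \<Phi> (apply_bcontfun u) (clamp a b t)" for u t
    unfolding A_def by (intro E \<Phi>_cont) simp
  have "\<exists>!u. A u = u"
  proof (rule ln_contraction_fixed_point)
    fix u v :: "real \<Rightarrow>\<^sub>C real"
    show "dist (A u) (A v) \<le> ln (1 + dist u v)"
    proof (rule dist_bound)
      fix t
      have "\<bar>integral {a..b} (\<lambda>s. G (clamp a b t) s * F s (u s)) -
          integral {a..b} (\<lambda>s. G (clamp a b t) s * F s (v s))\<bar> \<le> ln (1 + dist u v)"
        using dist_bounded[of u _ v]
        by (intro Hammerstein_operator_bound[OF F G G_nonneg G_int F_ln L] clamp_in)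
          (auto simp: dist_real_def)
      then show "dist (A u t) (A v t) \<le> ln (1 + dist u v)"
        by (simp add: A dist_real_def \<Phi>_def)
    qed
  qed
  then obtain u where u: "A u = u" and u_unique: "\<And>v. A v = v \<Longrightarrow> v = u"
    by blast
  have u_eq: "u t = \<Phi> u t" if "t \<in> {a..b}" for t
    using A[of u t] u clamp_id[OF that] by simp
  have "\<exists>!x. x \<in> extensional {a..b} \<and> continuous_on {a..b} x \<and> (\<forall>t\<in>{a..b}. x t = \<Phi> x t)"
  proof (intro ex1I[of _ "restrict (apply_bcontfun u) {a..b}"] conjI ballI)
    show "continuous_on {a..b} (restrict (apply_bcontfun u) {a..b})"
      by (rule continuous_on_eq[of _ "apply_bcontfun u"]) auto
    show "restrict u {a..b} t = \<Phi> (restrict u {a..b}) t" if "t \<in> {a..b}" for t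
      using u_eq[OF that] that \<Phi>_cong[of "restrict u {a..b}" u t] by simp
    fix x assume x: "x \<in> extensional {a..b} \<and> continuous_on {a..b} x \<and> (\<forall>t\<in>{a..b}. x t = \<Phi> x t)"
    then have Ex: "apply_bcontfun (E x) t = x (clamp a b t)" for t
      by (intro E) simp
    \<comment> \<open>Uniqueness: the extension of any solution is a fixed point of
      \<open>A\<close>, hence equals \<open>u\<close>; extensionality settles the points outside the
      interval.\<close>
    have "A (E x) = E x"
    proof (rule bcontfun_eqI)
      fix t
      have "\<Phi> (E x) (clamp a b t) = \<Phi> x (clamp a b t)"
        by (rule \<Phi>_cong) (simp add: Ex clamp_id)
      then show "A (E x) t = E x t"
        using x clamp_in[of t] by (simp add: A Ex)
    qed
    then have "E x = u"
      by (rule u_unique)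
    then have "x t = u t" if "t \<in> {a..b}" for t
      using Ex[of t] clamp_id[OF that] by simp
    then show "x = restrict u {a..b}"
      using x by (intro extensionalityI[of _ "{a..b}"]) auto
  qed simp
  then show ?thesis
    by (simp add: \<Phi>_def)
qed

section \<open>Reduction of the sum of 2m monotone terms to one nonlinearity\<close>

theorem theorem3p1:
  fixes T :: real and m :: nat
    and f :: "nat \<Rightarrow> real \<Rightarrow> real \<Rightarrow> real"
    and p :: "real \<Rightarrow> real"
    and G :: "real \<Rightarrow> real \<Rightarrow> real"
  assumes T: "T > 1" and m: "m \<ge> 1"
    and f_cont: "\<And>i. i \<in> {1..2*m} \<Longrightarrow> continuous_on ({1..T} \<times> UNIV) (\<lambda>(s, x). f i s x)"
    and p_cont: "continuous_on {1..T} p"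
    and G_cont: "continuous_on ({1..T} \<times> {1..T}) (\<lambda>(t, s). G t s)"
    and G_nonneg: "\<And>t s. t \<in> {1..T} \<Longrightarrow> s \<in> {1..T} \<Longrightarrow> 0 \<le> G t s"
    and nonzero: "2 * real m * max_kernel_integral T G \<noteq> 0"
    and f_bounds: "\<exists>\<eta> :: nat \<Rightarrow> real.
      (\<forall>i\<in>{1..2*m}. 0 < \<eta> i) \<and>
      Max (\<eta> ` {1..2*m}) \<le> inverse (2 * real m * max_kernel_integral T G) \<and>
      (\<forall>s\<in>{1..T}. \<forall>x y. x \<le> y \<longrightarrow> (\<forall>i\<in>{1..m}.
        0 \<le> f (2*i-1) s y - f (2*i-1) s x \<and>
        f (2*i-1) s y - f (2*i-1) s x \<le> \<eta> (2*i-1) * ln (1 + y - x) \<and>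
        - \<eta> (2*i) * ln (1 + y - x) \<le> f (2*i) s y - f (2*i) s x \<and>
        f (2*i) s y - f (2*i) s x \<le> 0))"
    and y0_exists: "\<exists>y0 :: nat \<Rightarrow> real \<Rightarrow> real.
      (\<forall>i\<in>{1..2*m}. continuous_on {1..T} (y0 i)) \<and>
      (\<forall>r\<in>{1..m}. \<forall>t\<in>{1..T}.
        y0 (2*r-1) t \<le> H T m G f p y0 (2*r-1) t \<and>
        y0 (2*r) t \<ge> H T m G f p y0 (2*r) t)"
  shows "\<exists>!x. hammerstein_solution T m G f p x"
proof -
  define K where "K = max_kernel_integral T G"
  \<comment> \<open>The bound on the \<eta> in hypothesis (d), used as a common constant for all
    terms; once \<open>K > 0\<close> is known, \<open>K * (2 * real m * c) = 1\<close>.\<close>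
  define c where "c = inverse (2 * real m * K)"
  define F where "F s x = (\<Sum>i=1..2*m. f i s x)" for s x
  have G_int: "integral {1..T} (G t) \<le> K" if "t \<in> {1..T}" for t
  proof -
    \<comment> \<open>A real supremum bounds its members only when the set is bounded above;
      compactness supplies this.\<close>
    have "compact ((\<lambda>t. integral {1..T} (G t)) ` {1..T})"
      by (intro compact_continuous_image continuous_on_param_integral G_cont) simp
    then have "bdd_above ((\<lambda>t. integral {1..T} (G t)) ` {1..T})"
      by (intro bounded_imp_bdd_above compact_imp_bounded)
    then show ?thesis
      unfolding K_def max_kernel_integral_def using that by (rule cSUP_upper[rotated])
  qed
  \<comment> \<open>Evaluating at the single point 1 gives \<open>K \<ge> 0\<close>, which the
    nonzero hypothesis turns into \<open>K > 0\<close>.\<close>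
  have "0 \<le> integral {1..T} (G 1)"
    using G_nonneg[of 1] T
    by (intro integral_nonneg integrable_continuous_interval continuous_on_section[OF G_cont]) auto
  with G_int[of 1] nonzero T have "K > 0"
    by (auto simp: K_def)
  then have c_pos: "c > 0"
    using m by (simp add: c_def)
  obtain \<eta> :: "nat \<Rightarrow> real" where
    \<eta>_max: "Max (\<eta> ` {1..2*m}) \<le> c" and
    \<eta>_f: "\<And>s x y i. s \<in> {1..T} \<Longrightarrow> x \<le> y \<Longrightarrow> i \<in> {1..m} \<Longrightarrow>
        0 \<le> f (2*i-1) s y - f (2*i-1) s x \<and>
        f (2*i-1) s y - f (2*i-1) s x \<le> \<eta> (2*i-1) * ln (1 + y - x) \<and>
        - \<eta> (2*i) * ln (1 + y - x) \<le> f (2*i) s y - f (2*i) s x \<and>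
        f (2*i) s y - f (2*i) s x \<le> 0"
    using f_bounds unfolding c_def K_def by blast
  have \<eta>_le: "\<eta> i \<le> c" if "i \<in> {1..2*m}" for i
    using \<eta>_max that by (meson Max_ge finite_atLeastAtMost finite_imageI imageI order_trans)
  \<comment> \<open>The parity of \<open>i\<close> fixes the sign of the difference; in either case
    (d) bounds its absolute value by the same logarithm.\<close>
  have f_ln_ordered: "\<bar>f i s y - f i s x\<bar> \<le> c * ln (1 + (y - x))"
    if i: "i \<in> {1..2*m}" and s: "s \<in> {1..T}" and "x \<le> y" for i s x y
  proof -
    have ln_nonneg: "ln (1 + (y - x)) \<ge> 0"
      using \<open>x \<le> y\<close> by simp
    have "\<bar>f i s y - f i s x\<bar> \<le> \<eta> i * ln (1 + (y - x))"
    proof (cases "even i")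
      case True
      then obtain j where j: "i = 2 * j" by blast
      with i have "j \<in> {1..m}" by auto
      from \<eta>_f[OF s \<open>x \<le> y\<close> this] show ?thesis
        by (simp add: j abs_le_iff algebra_simps)
    next
      case False
      then obtain j where j: "i = 2 * j + 1" by (rule oddE)
      \<comment> \<open>Since \<open>2 * Suc j - 1 = 2 * j + 1\<close>, the odd index
        \<open>i\<close> is reached in (d) at \<open>Suc j\<close>, not at \<open>j\<close>.\<close>
      with i have "Suc j \<in> {1..m}" by auto
      from \<eta>_f[OF s \<open>x \<le> y\<close> this] show ?thesis
        by (simp add: j abs_le_iff algebra_simps)
    qed
    also have "\<dots> \<le> c * ln (1 + (y - x))"
      using \<eta>_le[OF i] ln_nonneg by (rule mult_right_mono)
    finally show ?thesis .
  qed
  have f_ln: "\<bar>f i s x - f i s y\<bar> \<le> c * ln (1 + \<bar>x - y\<bar>)"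
    if "i \<in> {1..2*m}" "s \<in> {1..T}" for i s x y
    using f_ln_ordered[OF that, of x y] f_ln_ordered[OF that, of y x]
    by (cases "x \<le> y") (simp_all add: abs_minus_commute)
  have F_ln: "\<bar>F s x - F s y\<bar> \<le> (2 * real m * c) * ln (1 + \<bar>x - y\<bar>)" if "s \<in> {1..T}" for s x y
  proof -
    have "\<bar>F s x - F s y\<bar> \<le> (\<Sum>i=1..2*m. \<bar>f i s x - f i s y\<bar>)"
      unfolding F_def by (simp flip: sum_subtractf)
    also have "\<dots> \<le> (\<Sum>i=1..2*m. c * ln (1 + \<bar>x - y\<bar>))"
      using that by (intro sum_mono f_ln)
    finally show ?thesis by simp
  qed
  have F_cont: "continuous_on ({1..T} \<times> UNIV) (\<lambda>(s, x). F s x)"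
    using f_cont unfolding F_def case_prod_unfold by (intro continuous_on_sum)
  have "K * (2 * real m * c) \<le> 1"
    using \<open>K > 0\<close> m by (simp add: c_def field_simps)
  then have "\<exists>!x. x \<in> extensional {1..T} \<and> continuous_on {1..T} x \<and>
      (\<forall>t\<in>{1..T}. x t = integral {1..T} (\<lambda>s. G t s * F s (x s)) + p t)"
    using T c_pos
    by (intro Hammerstein_unique_solution[OF _ F_cont p_cont G_cont G_nonneg G_int F_ln]) auto
  then show ?thesis
    by (simp add: hammerstein_solution_def C_space_def F_def conj_assoc)
qed

end
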